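(* Let $\mathcal{H}=\{h_x\}_{x\in\mathcal{X}}$ be the class of threshold functions over a totally ordered (possibly infinite) domain $\mathcal{X}$, where $h_x(y)=1$ if $y\le x$ and $h_x(y)=0$ if $y>x$. There exists a compression learner for $\mathcal{H}$ such that, when given an input sample $S_L\sim_{i.i.d.}\mathcal{D}_L^n$ of size $n$ labelled by a target threshold in $\mathcal{H}$, it is both $(\varepsilon,\delta)$-accurate and $(\varepsilon,\delta)$-robustly generalizing, for any $\delta\in(0,1)$ and \[\varepsilon=O\left(\sqrt{\frac{\log(n/\delta)}{n}}\right),\] as long as $n\ge 8\log(2n/\delta)$.
   Context: PAC setting: examples $x_i$ are drawn i.i.d. from a distribution $\mathcal{D}$ over $\mathcal{X}$ and labelled $z_i=(x_i,h^*(x_i))$ by some target $h^*\in\mathcal{H}$; $err(h)=\Pr_{x\sim\mathcal{D}}[h(x)\ne h^*(x)]$. A learner is $(\varepsilon,\delta)$-accurate if its output $h\in\mathcal{H}$ satisfies $\Pr[err(h)\le\varepsilon]\ge1-\delta$ (over the sample and the learner's randomness). A compression learner of size $k$ is a map $B\circ A$ where $A$ maps a sample $S_L$ of $n$ labelled examples to a sequence of at most $k$ examples from $S_L$ and $B$ maps that sequence to a hypothesis in $\mathcal{H}$ that is an empirical risk minimizer on $S_L$. Robust generalization: a mechanism $\mathcal{M}\colon(\mathcal{X}\times\{0,1\})^n\to\mathcal{R}$ is $(\varepsilon,\delta)$-robustly generalizing if for every distribution $\mathcal{D}_L$ over $\mathcal{X}\times\{0,1\}$ and every adversary $\mathcal{A}$,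 with probability $1-\zeta$ over $S_L\sim_{i.i.d.}\mathcal{D}_L^n$, $\Pr[\mathcal{A}(\mathcal{M}(S_L))\text{ outputs } h \text{ with } |h(S_L)-h(\mathcal{D}_L)|\le\varepsilon]\ge1-\gamma$ for some $\zeta,\gamma$ with $\delta=\zeta+\gamma$, where $h$ is $\{0,1\}$-valued, $h(S_L)$ is its sample average and $h(\mathcal{D}_L)$ its expectation.
   Formalization: Added: thresholds are measurable and, for accuracy, the order relation is measurable up to D×D-null sets; the adversary's output is jointly measurable in sample, seed and point. On arbitrary total orders with arbitrary distributions the claim is false. *)

theory Defs
  imports "HOL-Probability.Probability"
begin

definition threshold :: "'a::linorder \<Rightarrow> 'a \<Rightarrow> bool" where
  "threshold x y \<longleftrightarrow> y \<le> x"

definition threshold_class :: "('a::linorder \<Rightarrow> bool) set" where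
  "threshold_class = range threshold"

definition emp_err :: "('a \<Rightarrow> bool) \<Rightarrow> ('a \<times> bool) list \<Rightarrow> real" where
  "emp_err h S = real (length (filter (\<lambda>(x, y). h x \<noteq> y) S)) / real (length S)"

definition is_erm :: "('a \<Rightarrow> bool) set \<Rightarrow> ('a \<times> bool) list \<Rightarrow> ('a \<Rightarrow> bool) \<Rightarrow> bool" where
  "is_erm H S h \<longleftrightarrow> h \<in> H \<and> (\<forall>h'\<in>H. emp_err h S \<le> emp_err h' S)"

text \<open>Samples of every length and with arbitrary labels are allowed: \<open>B (A S)\<close> has to be an
  empirical risk minimizer also when no hypothesis in \<open>H\<close> is consistent with \<open>S\<close>.\<close>

definition compression_learner ::
  "('a \<Rightarrow> bool) set \<Rightarrow> nat \<Rightarrow> (('a \<times> bool) list \<Rightarrow> ('a \<times> bool) list)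
    \<Rightarrow> (('a \<times> bool) list \<Rightarrow> ('a \<Rightarrow> bool)) \<Rightarrow> bool" where
  "compression_learner H k A B \<longleftrightarrow>
     (\<forall>S. length (A S) \<le> k \<and> set (A S) \<subseteq> set S \<and> is_erm H S (B (A S)))"

text \<open>An event has probability at least \<open>p\<close> in the sense of inner measure. For measurable
  events this is \<open>measure M {x \<in> space M. P x} \<ge> p\<close>; without measurability that inequality
  would not be meaningful, since \<open>measure\<close> is \<open>0\<close> outside \<open>sets M\<close>.\<close>

definition prob_at_least :: "'a measure \<Rightarrow> real \<Rightarrow> ('a \<Rightarrow> bool) \<Rightarrow> bool" where
  "prob_at_least M p P \<longleftrightarrow> (\<exists>E\<in>sets M. E \<subseteq> {x \<in> space M. P x} \<and> measure M E \<ge> p)"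

definition iid :: "nat \<Rightarrow> 'z measure \<Rightarrow> (nat \<Rightarrow> 'z) measure" where
  "iid n D = PiM {..<n} (\<lambda>_. D)"

definition sample :: "nat \<Rightarrow> (nat \<Rightarrow> 'z) \<Rightarrow> 'z list" where
  "sample n s = map s [0..<n]"

text \<open>Distributions over a totally ordered domain, on any sigma-algebra for which each threshold
  function is measurable and for which the map \<open>(x, y) \<mapsto> threshold y x\<close> is measurable up to
  \<open>D \<otimes> D\<close>-null sets. The second requirement holds for all discrete distributions on any total
  order and for all Borel distributions on a second countable order topology. It excludes
  distributions such as the countable/co-countable measure on the first uncountable ordinal, which
  gives every initial segment probability \<open>0\<close>, so that there a threshold at the
  largest of finitely many sampled points always has mass \<open>0\<close> below it.\<close>

definition order_distribution :: "'a::linorder measure \<Rightarrow> bool" where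
  "order_distribution D \<longleftrightarrow> prob_space D \<and> space D = UNIV \<and> (\<forall>x. {..x} \<in> sets D) \<and>
     {(x, y). x \<le> y} \<in> sets (completion (D \<Otimes>\<^sub>M D))"

definition err :: "'a measure \<Rightarrow> ('a \<Rightarrow> bool) \<Rightarrow> ('a \<Rightarrow> bool) \<Rightarrow> real" where
  "err D hstar h = measure D {x \<in> space D. h x \<noteq> hstar x}"

definition accurate ::
  "('a::linorder \<Rightarrow> bool) set \<Rightarrow> nat \<Rightarrow> real \<Rightarrow> real
    \<Rightarrow> (('a \<times> bool) list \<Rightarrow> ('a \<Rightarrow> bool)) \<Rightarrow> bool" where
  "accurate H n \<epsilon> \<delta> L \<longleftrightarrow>
     (\<forall>D. \<forall>hstar\<in>H. order_distribution D \<longrightarrow>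
        prob_at_least (iid n D) (1 - \<delta>)
          (\<lambda>xs. L (sample n (\<lambda>i. (xs i, hstar (xs i)))) \<in> H \<and>
                err D hstar (L (sample n (\<lambda>i. (xs i, hstar (xs i))))) \<le> \<epsilon>))"

definition sample_average :: "nat \<Rightarrow> (nat \<Rightarrow> 'z) \<Rightarrow> ('z \<Rightarrow> bool) \<Rightarrow> real" where
  "sample_average n s h = (\<Sum>i<n. of_bool (h (s i))) / real n"

definition expected_value :: "'z measure \<Rightarrow> ('z \<Rightarrow> bool) \<Rightarrow> real" where
  "expected_value D h = (\<integral>z. of_bool (h z) \<partial>D)"

text \<open>A randomized adversary is a function of the output of the mechanism and of a random seed,
  drawn from a probability space \<open>Q\<close> over the reals of its own choice. Its output, evaluated at a
  point, must be jointly measurable in the sample, the seed and the point. This is implied by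
  measurability of the mechanism into any measurable space of outputs together with joint
  measurability of the adversary on that space.\<close>

definition adversary ::
  "nat \<Rightarrow> ('z list \<Rightarrow> 'r) \<Rightarrow> 'z measure \<Rightarrow> real measure
    \<Rightarrow> ('r \<Rightarrow> real \<Rightarrow> 'z \<Rightarrow> bool) \<Rightarrow> bool" where
  "adversary n L D Q Adv \<longleftrightarrow> prob_space Q \<and>
     (\<lambda>(s, \<omega>, z). Adv (L (sample n s)) \<omega> z)
       \<in> measurable (iid n D \<Otimes>\<^sub>M (Q \<Otimes>\<^sub>M D)) (count_space UNIV)"

definition robustly_generalizing ::
  "nat \<Rightarrow> real \<Rightarrow> real \<Rightarrow> (('a \<times> bool) list \<Rightarrow> 'r) \<Rightarrow> bool" where
  "robustly_generalizing n \<epsilon> \<delta> L \<longleftrightarrow>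
     (\<exists>\<zeta> \<gamma>. \<zeta> \<ge> 0 \<and> \<gamma> \<ge> 0 \<and> \<delta> = \<zeta> + \<gamma> \<and>
       (\<forall>(D :: ('a \<times> bool) measure) Q Adv.
          prob_space D \<and> space D = UNIV \<and> adversary n L D Q Adv \<longrightarrow>
          prob_at_least (iid n D) (1 - \<zeta>)
            (\<lambda>s. prob_at_least Q (1 - \<gamma>)
              (\<lambda>\<omega>. let h = Adv (L (sample n s)) \<omega>
                   in \<bar>sample_average n s h - expected_value D h\<bar> \<le> \<epsilon>))))"

end

theory Submission
  imports Defs
begin

text \<open>The learner keeps either the sample point that is the best threshold, or the smallest sample
  point together with a marker saying that the threshold lies below it.

  Accuracy: if the error exceeds \<open>\<epsilon>\<close>, then for some \<open>i\<close> the region between the target and \<open>x\<^sub>i\<close>,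
  or the region below the target, has mass more than \<open>\<epsilon>\<close> and contains none of the other \<open>n - 1\<close>
  points. Conditioning on \<open>x\<^sub>i\<close> bounds each of these \<open>n + 1\<close> events by \<open>exp (- \<epsilon> (n - 1))\<close>.

  Robust generalization: fix the seed of the adversary and draw a ghost sample of size \<open>n\<close>. Under a
  random exchange of corresponding points of the two samples, the compressed sequence ranges over the
  boundedly many short lists over the \<open>2n\<close> points, and for each fixed list the difference
  of the two averages is a Rademacher sum. Fubini and Markov's inequality then split \<open>\<delta>\<close> evenly
  between the sample and the seed.\<close>

section \<open>Symmetrization for compression schemes\<close>

text \<open>This is \<open>cosh x \<le> exp (x\<^sup>2 / 2)\<close>, the moment bound for a fair
  sign. For \<open>x \<ge> 0\<close> it comes from Hoeffding's lemma for a fair coin with step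
  \<open>2 * x\<close>, after multiplication by \<open>exp (- x)\<close>; evenness covers the
  rest.\<close>

lemma exp_add_exp_minus_le:
  fixes x :: real
  shows "exp x + exp (- x) \<le> 2 * exp (x\<^sup>2 / 2)"
proof -
  have *: "exp x + exp (- x) \<le> 2 * exp (x\<^sup>2 / 2)" if "x \<ge> 0" for x :: real
  proof -
    have pos: "1 + 1 / 2 * (exp (2 * x) - 1) > (0::real)"
      by (simp add: field_simps add_pos_pos)
    have "ln (1 + 1 / 2 * (exp (2 * x) - 1)) \<le> x\<^sup>2 / 2 + x"
      using Hoeffdings_lemma_aux[of "2 * x" "1 / 2"] that by (simp add: power2_eq_square)
    then have "1 + 1 / 2 * (exp (2 * x) - 1) \<le> exp (x\<^sup>2 / 2 + x)"
      using pos by (metis exp_le_cancel_iff exp_ln)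
    then have "1 + exp (2 * x) \<le> 2 * exp (x\<^sup>2 / 2 + x)"
      by (simp add: field_simps)
    then have "exp (- x) * (1 + exp (2 * x)) \<le> exp (- x) * (2 * exp (x\<^sup>2 / 2 + x))"
      by (intro mult_left_mono) auto
    then show ?thesis
      by (simp add: distrib_left mult.left_commute add.commute flip: exp_add)
  qed
  show ?thesis
    using *[of x] *[of "- x"] by (cases "x \<ge> 0") (auto simp: add.commute)
qed

text \<open>Chernoff's method with counting in place of probability: \<open>J\<close> is the set of
  flipped signs, and the sum of \<open>exp (t * S J)\<close> over all \<open>J\<close> factors into
  one sum of two exponentials per index.\<close>

lemma card_signed_sum_gt:
  fixes d :: "'i \<Rightarrow> real" and t :: real
  assumes fin: "finite I" and d: "\<And>i. i \<in> I \<Longrightarrow> \<bar>d i\<bar> \<le> 1" and t: "t \<ge> 0"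
  shows "real (card {J \<in> Pow I. (\<Sum>i\<in>I. if i \<in> J then - d i else d i) > real (card I) * t})
    \<le> 2 ^ card I * exp (- (real (card I) * t\<^sup>2 / 2))"
proof -
  define S where "S J = (\<Sum>i\<in>I. if i \<in> J then - d i else d i)" for J
  define n where "n = card I"
  let ?B = "{J \<in> Pow I. S J > real n * t}"
  have finB: "finite ?B" using fin by auto
  \<comment> \<open>The Chernoff parameter is \<open>t\<close> itself: it minimizes
    \<open>n * s^2 / 2 - s * n * t\<close> over \<open>s\<close> and leaves the exponent
    \<open>- n * t^2 / 2\<close>.\<close>
  have "real (card ?B) * exp (t * (real n * t)) = (\<Sum>J\<in>?B. exp (t * (real n * t)))"
    by simp
  also have "\<dots> \<le> (\<Sum>J\<in>?B. exp (t * S J))"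
    using t by (intro sum_mono) (auto intro!: mult_left_mono)
  also have "\<dots> \<le> (\<Sum>J\<in>Pow I. exp (t * S J))"
    using fin by (intro sum_mono2) auto
  also have "\<dots> = (\<Sum>J\<in>Pow I. (\<Prod>i\<in>J. exp (- (t * d i))) * (\<Prod>i\<in>I - J. exp (t * d i)))"
  proof (rule sum.cong)
    fix J assume J: "J \<in> Pow I"
    have "exp (t * S J) = (\<Prod>i\<in>I. exp (t * (if i \<in> J then - d i else d i)))"
      unfolding S_def sum_distrib_left using fin by (rule exp_sum)
    also have "\<dots> = (\<Prod>i\<in>I - J. exp (t * (if i \<in> J then - d i else d i))) *
        (\<Prod>i\<in>J. exp (t * (if i \<in> J then - d i else d i)))"
      using J fin by (intro prod.subset_diff) auto
    finally show "exp (t * S J) = (\<Prod>i\<in>J. exp (- (t * d i))) * (\<Prod>i\<in>I - J. exp (t * d i))"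
      by (simp add: mult.commute)
  qed simp
  also have "\<dots> = (\<Prod>i\<in>I. exp (- (t * d i)) + exp (t * d i))"
    using fin by (rule prod_add[symmetric])
  also have "\<dots> \<le> (\<Prod>i\<in>I. 2 * exp (t\<^sup>2 / 2))"
  proof (rule prod_mono)
    fix i assume i: "i \<in> I"
    have "exp (- (t * d i)) + exp (t * d i) \<le> 2 * exp ((t * d i)\<^sup>2 / 2)"
      using exp_add_exp_minus_le[of "t * d i"] by (simp add: add.commute)
    also have "\<dots> \<le> 2 * exp (t\<^sup>2 / 2)"
      using d[OF i] by (simp add: power_mult_distrib mult_left_le abs_square_le_1)
    finally show "0 \<le> exp (- (t * d i)) + exp (t * d i) \<and>
        exp (- (t * d i)) + exp (t * d i) \<le> 2 * exp (t\<^sup>2 / 2)"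
      by (simp add: add_nonneg_nonneg)
  qed
  also have "\<dots> = 2 ^ n * exp (real n * t\<^sup>2 / 2)"
    by (simp add: n_def power_mult_distrib exp_of_nat_mult[symmetric])
  finally have "real (card ?B) * exp (t * (real n * t)) * exp (- (t * (real n * t)))
      \<le> 2 ^ n * exp (real n * t\<^sup>2 / 2) * exp (- (t * (real n * t)))"
    by (rule mult_right_mono) simp
  then show ?thesis
    unfolding S_def[symmetric] n_def[symmetric]
    by (simp add: mult.assoc flip: exp_add) (simp add: power2_eq_square algebra_simps)
qed

lemma card_abs_signed_sum_gt:
  fixes d :: "'i \<Rightarrow> real" and t :: real
  assumes fin: "finite I" and d: "\<And>i. i \<in> I \<Longrightarrow> \<bar>d i\<bar> \<le> 1" and t: "t \<ge> 0"
  shows "real (card {J \<in> Pow I. \<bar>\<Sum>i\<in>I. if i \<in> J then - d i else d i\<bar> > real (card I) * t})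
    \<le> 2 ^ card I * (2 * exp (- (real (card I) * t\<^sup>2 / 2)))"
proof -
  let ?P = "\<lambda>d. {J \<in> Pow I. (\<Sum>i\<in>I. if i \<in> J then - d i else d i) > real (card I) * t}"
  have neg: "(\<Sum>i\<in>I. if i \<in> J then - (- d i) else - d i) = - (\<Sum>i\<in>I. if i \<in> J then - d i else d i)" for J
    unfolding sum_negf[symmetric] by (rule sum.cong) auto
  have "{J \<in> Pow I. \<bar>\<Sum>i\<in>I. if i \<in> J then - d i else d i\<bar> > real (card I) * t}
      \<subseteq> ?P d \<union> ?P (\<lambda>i. - d i)"
    unfolding neg by (auto simp: abs_if split: if_split_asm)
  then have "card {J \<in> Pow I. \<bar>\<Sum>i\<in>I. if i \<in> J then - d i else d i\<bar> > real (card I) * t}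
      \<le> card (?P d \<union> ?P (\<lambda>i. - d i))"
    using fin by (intro card_mono) auto
  also have "\<dots> \<le> card (?P d) + card (?P (\<lambda>i. - d i))"
    by (rule card_Un_le)
  finally show ?thesis
    using card_signed_sum_gt[of I d t, OF fin d t] card_signed_sum_gt[of I "\<lambda>i. - d i" t, OF fin _ t] d
    by simp
qed

section \<open>Exchanging corresponding points of a double sample\<close>

text \<open>Positions \<open>i\<close> and \<open>n + i\<close> form a pair, and \<open>J\<close>
  selects the pairs to be exchanged. For \<open>J\<close> within the first half this is an
  involution, hence a permutation of the \<open>2 * n\<close> positions.\<close>

definition swap_halves :: "nat \<Rightarrow> nat set \<Rightarrow> nat \<Rightarrow> nat" where
  "swap_halves n J i =
     (if i < n then if i \<in> J then n + i else i else if i - n \<in> J then i - n else i)"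

lemma swap_halves_less: "J \<subseteq> {..<n} \<Longrightarrow> i < 2 * n \<Longrightarrow> swap_halves n J i < 2 * n"
  by (auto simp: swap_halves_def)

lemma swap_halves_involution: "J \<subseteq> {..<n} \<Longrightarrow> swap_halves n J (swap_halves n J i) = i"
  by (auto simp: swap_halves_def)

lemma inj_swap_halves: "J \<subseteq> {..<n} \<Longrightarrow> inj_on (swap_halves n J) A"
  by (metis inj_on_inverseI swap_halves_involution)

text \<open>Exchanging a pair negates its own difference and no other, so random exchanges turn the
  gap between the halves into a Rademacher sum.\<close>

lemma swap_sum_diff:
  fixes f :: "'z \<Rightarrow> real"
  shows "(\<Sum>i<n. f (w (swap_halves n J i))) - (\<Sum>i<n. f (w (swap_halves n J (n + i)))) =
    (\<Sum>i<n. if i \<in> J then - (f (w i) - f (w (n + i))) else f (w i) - f (w (n + i)))"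
  unfolding sum_subtractf[symmetric] by (rule sum.cong) (auto simp: swap_halves_def)

definition double_dev :: "nat \<Rightarrow> ('z \<Rightarrow> bool) \<Rightarrow> (nat \<Rightarrow> 'z) \<Rightarrow> real" where
  "double_dev n h w = \<bar>(\<Sum>i<n. of_bool (h (w i))) - (\<Sum>i<n. of_bool (h (w (n + i))))\<bar>"

lemma sample_cong: "(\<And>i. i < n \<Longrightarrow> s i = s' i) \<Longrightarrow> sample n s = sample n s'"
  by (simp add: sample_def)

lemma set_sample: "set (sample n s) = s ` {..<n}"
  by (simp add: sample_def atLeast0LessThan)

text \<open>Whatever \<open>J\<close> is, the compressed list has at most \<open>k\<close> entries
  among the at most \<open>2 * n\<close> values of \<open>w\<close>, so it lies in the finite set
  \<open>TT\<close>, which does not depend on \<open>J\<close>. For a fixed list the hypothesis is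
  fixed too and the tail bound for signed sums applies; the union bound over \<open>TT\<close> gives
  the factor in front.\<close>

lemma card_double_dev_gt:
  fixes t :: real and n :: nat
  assumes A: "\<And>S. length (A S) \<le> k \<and> set (A S) \<subseteq> set S" and t: "t \<ge> 0"
  shows "real (card {J \<in> Pow {..<n}. double_dev n (g (A (sample n (w \<circ> swap_halves n J))))
      (w \<circ> swap_halves n J) > real n * t})
    \<le> 2 ^ n * (real (\<Sum>i\<le>k. (2 * n) ^ i) * (2 * exp (- (real n * t\<^sup>2 / 2))))"
proof -
  define X where "X = w ` {..<2 * n}"
  define TT where "TT = {T. set T \<subseteq> X \<and> length T \<le> k}"
  define B where "B T = {J \<in> Pow {..<n}. double_dev n (g T) (w \<circ> swap_halves n J) > real n * t}" for T
  have finX: "finite X" and cardX: "card X \<le> 2 * n"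
    unfolding X_def using card_image_le[of "{..<2*n}" w] by auto
  have finTT: "finite TT" unfolding TT_def by (rule finite_lists_length_le[OF finX])
  have "card TT = (\<Sum>i\<le>k. card X ^ i)"
    unfolding TT_def by (rule card_lists_length_le[OF finX])
  also have "\<dots> \<le> (\<Sum>i\<le>k. (2 * n) ^ i)"
    using cardX by (intro sum_mono power_mono) auto
  finally have cardTT: "card TT \<le> (\<Sum>i\<le>k. (2 * n) ^ i)" .
  have B: "real (card (B T)) \<le> 2 ^ n * (2 * exp (- (real n * t\<^sup>2 / 2)))" for T
  proof -
    let ?d = "\<lambda>i. of_bool (g T (w i)) - of_bool (g T (w (n + i))) :: real"
    have "B T = {J \<in> Pow {..<n}. \<bar>\<Sum>i<n. if i \<in> J then - ?d i else ?d i\<bar> > real (card {..<n}) * t}"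
      unfolding B_def double_dev_def comp_def card_lessThan
        swap_sum_diff[where f="\<lambda>z. of_bool (g T z)"] ..
    then show ?thesis
      using card_abs_signed_sum_gt[of "{..<n}" ?d t] t by (simp only: card_lessThan) auto
  qed
  have "{J \<in> Pow {..<n}. double_dev n (g (A (sample n (w \<circ> swap_halves n J))))
      (w \<circ> swap_halves n J) > real n * t} \<subseteq> (\<Union>T\<in>TT. B T)"
  proof clarify
    fix J assume J: "J \<subseteq> {..<n}"
      and dev: "double_dev n (g (A (sample n (w \<circ> swap_halves n J)))) (w \<circ> swap_halves n J) > real n * t"
    have "set (sample n (w \<circ> swap_halves n J)) \<subseteq> X"
      using swap_halves_less[OF J] by (force simp: set_sample X_def)
    then have "A (sample n (w \<circ> swap_halves n J)) \<in> TT"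
      using A[of "sample n (w \<circ> swap_halves n J)"] by (auto simp: TT_def)
    then show "J \<in> (\<Union>T\<in>TT. B T)"
      using J dev by (auto simp: B_def)
  qed
  then have "card {J \<in> Pow {..<n}. double_dev n (g (A (sample n (w \<circ> swap_halves n J))))
      (w \<circ> swap_halves n J) > real n * t} \<le> card (\<Union>T\<in>TT. B T)"
    using finTT by (intro card_mono) (auto simp: B_def)
  also have "\<dots> \<le> (\<Sum>T\<in>TT. card (B T))"
    using finTT by (rule card_UN_le)
  finally have "real (card {J \<in> Pow {..<n}. double_dev n (g (A (sample n (w \<circ> swap_halves n J))))
      (w \<circ> swap_halves n J) > real n * t}) \<le> real (\<Sum>T\<in>TT. card (B T))"
    by (rule of_nat_mono)
  also have "\<dots> \<le> (\<Sum>T\<in>TT. 2 ^ n * (2 * exp (- (real n * t\<^sup>2 / 2))))"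
    unfolding of_nat_sum by (intro sum_mono B)
  also have "\<dots> = real (card TT) * (2 ^ n * (2 * exp (- (real n * t\<^sup>2 / 2))))"
    by simp
  also have "\<dots> \<le> real (\<Sum>i\<le>k. (2 * n) ^ i) * (2 ^ n * (2 * exp (- (real n * t\<^sup>2 / 2))))"
    using cardTT by (intro mult_right_mono of_nat_mono) auto
  finally show ?thesis by (simp add: mult_ac)
qed

text \<open>The adversary is measurable only as a function of the whole sample, so a union bound over the
  indices selected by the compression would involve non-measurable events. Averaging over swaps
  instead reduces everything to counting for a fixed double sample.\<close>

lemma symmetrization:
  fixes D :: "'z measure" and t :: real and n :: nat
  assumes D: "prob_space D"
    and A: "\<And>S. length (A S) \<le> k \<and> set (A S) \<subseteq> set S" and t: "t \<ge> 0"
    and W: "{w \<in> space (PiM {..<2 * n} (\<lambda>_. D)). double_dev n (g (A (sample n w))) w > real n * t}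
      \<in> sets (PiM {..<2 * n} (\<lambda>_. D))"
  shows "emeasure (PiM {..<2 * n} (\<lambda>_. D))
      {w \<in> space (PiM {..<2 * n} (\<lambda>_. D)). double_dev n (g (A (sample n w))) w > real n * t}
    \<le> ennreal (real (\<Sum>i\<le>k. (2 * n) ^ i) * (2 * exp (- (real n * t\<^sup>2 / 2))))"
proof -
  let ?P = "PiM {..<2 * n} (\<lambda>_. D)"
  let ?W = "{w \<in> space ?P. double_dev n (g (A (sample n w))) w > real n * t}"
  let ?K = "real (\<Sum>i\<le>k. (2 * n) ^ i) * (2 * exp (- (real n * t\<^sup>2 / 2)))"
  interpret P: prob_space ?P by (intro prob_space_PiM D)
  define r where "r J w = (\<lambda>i\<in>{..<2*n}. (w (swap_halves n J i) :: 'z))" for J w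
  have r_meas [measurable]: "r J \<in> measurable ?P ?P" if "J \<subseteq> {..<n}" for J
    unfolding r_def
    by (intro measurable_restrict measurable_component_singleton) (use swap_halves_less[OF that] in auto)
  have r_distr: "distr ?P ?P (r J) = ?P" if "J \<subseteq> {..<n}" for J
    unfolding r_def using swap_halves_less[OF that] inj_swap_halves[OF that] D
    by (intro distr_PiM_reindex[where M="\<lambda>_. D"]) auto
  \<comment> \<open>An i.i.d. product is invariant under permuting its coordinates, so every swap
    preserves the measure of the bad event; summing over all \<open>2 ^ n\<close> swaps leaves a
    count for each fixed \<open>w\<close>.\<close>
  have inv: "emeasure ?P ?W = (\<integral>\<^sup>+w. indicator ?W (r J w) \<partial>?P)" if J: "J \<subseteq> {..<n}" for J
  proof -
    have "emeasure ?P ?W = (\<integral>\<^sup>+w. indicator ?W w \<partial>distr ?P ?P (r J))"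
      using W by (simp add: r_distr[OF J])
    also have "\<dots> = (\<integral>\<^sup>+w. indicator ?W (r J w) \<partial>?P)"
      using W J by (intro nn_integral_distr) auto
    finally show ?thesis .
  qed
  have "ennreal (2 ^ n) * emeasure ?P ?W = (\<Sum>J\<in>Pow {..<n}. emeasure ?P ?W)"
    by (simp add: card_Pow flip: ennreal_power)
  also have "\<dots> = (\<Sum>J\<in>Pow {..<n}. (\<integral>\<^sup>+w. indicator ?W (r J w) \<partial>?P))"
    using inv by (intro sum.cong) auto
  also have "\<dots> = (\<integral>\<^sup>+w. (\<Sum>J\<in>Pow {..<n}. indicator ?W (r J w)) \<partial>?P)"
    using W by (intro nn_integral_sum[symmetric]) (auto intro!: measurable_compose[OF r_meas])
  also have "\<dots> \<le> (\<integral>\<^sup>+w. ennreal (2 ^ n * ?K) \<partial>?P)"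
  proof (rule nn_integral_mono)
    fix w
    let ?Q = "{J \<in> Pow {..<n}. double_dev n (g (A (sample n (w \<circ> swap_halves n J))))
      (w \<circ> swap_halves n J) > real n * t}"
    have "sample n (r J w) = sample n (w \<circ> swap_halves n J)" for J
      by (rule sample_cong) (auto simp: r_def)
    moreover have "double_dev n h (r J w) = double_dev n h (w \<circ> swap_halves n J)" for h J
      by (simp add: double_dev_def r_def)
    ultimately have "(\<Sum>J\<in>Pow {..<n}. indicator ?W (r J w))
        \<le> (\<Sum>J\<in>Pow {..<n}. indicator ?Q J :: ennreal)"
      by (intro sum_mono) (auto simp: indicator_def)
    also have "\<dots> = of_nat (card ?Q)"
      unfolding indicator_def by (subst sum_of_bool_eq) (auto intro!: arg_cong[where f=card])
    also have "(of_nat (card ?Q) :: ennreal) = ennreal (real (card ?Q))"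
      by (simp add: ennreal_of_nat_eq_real_of_nat)
    also have "\<dots> \<le> ennreal (2 ^ n * ?K)"
      using card_double_dev_gt[OF A t, where g=g and w=w and n=n] by (intro ennreal_leI)
    finally show "(\<Sum>J\<in>Pow {..<n}. indicator ?W (r J w)) \<le> ennreal (2 ^ n * ?K)" .
  qed
  also have "\<dots> = ennreal (2 ^ n) * ennreal ?K"
    unfolding nn_integral_const P.emeasure_space_1 mult_1_right
    by (intro ennreal_mult zero_le_power mult_nonneg_nonneg of_nat_0_le_iff exp_ge_zero zero_le_numeral)
  finally show ?thesis
    by (subst (asm) ennreal_mult_le_mult_iff) auto
qed

section \<open>From a ghost sample to the expectation\<close>

text \<open>Supplies the concentration of the ghost sample. The coordinates are independent because
  their joint map is the identity on the product space, whose law is the product of the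
  marginals.\<close>

lemma Hoeffding_PiM:
  fixes D :: "'z measure" and \<phi> :: "'z \<Rightarrow> real"
  assumes D: "prob_space D" and \<phi> [measurable]: "\<phi> \<in> borel_measurable D"
    and bd: "\<And>z. \<phi> z \<in> {0..1}" and J: "finite J" "J \<noteq> {}" and c: "c \<ge> 0"
  shows "measure (PiM J (\<lambda>_. D))
      {w \<in> space (PiM J (\<lambda>_. D)). \<bar>(\<Sum>j\<in>J. \<phi> (w j)) - card J * (\<integral>z. \<phi> z \<partial>D)\<bar> \<ge> c}
    \<le> 2 * exp (- 2 * c\<^sup>2 / card J)"
proof -
  let ?P = "PiM J (\<lambda>_. D)"
  interpret D: prob_space D by fact
  interpret P: prob_space ?P by (intro prob_space_PiM D)
  have comp: "distr ?P D (\<lambda>w. w j) = D" if "j \<in> J" for j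
    using that D by (intro distr_PiM_component) auto
  have "P.indep_vars (\<lambda>_. D) (\<lambda>j w. w j) J"
  proof (subst P.indep_vars_iff_distr_eq_PiM'[OF J(2)])
    have "distr ?P ?P (\<lambda>w. \<lambda>i\<in>J. w i) = distr ?P ?P (\<lambda>w. w)"
      by (rule distr_cong) (auto simp: space_PiM PiE_restrict)
    also have "\<dots> = PiM J (\<lambda>i. distr ?P D (\<lambda>w. w i))"
      unfolding distr_id by (intro PiM_cong) (simp_all add: comp)
    finally show "distr ?P ?P (\<lambda>w. \<lambda>i\<in>J. w i) = PiM J (\<lambda>i. distr ?P D (\<lambda>w. w i))" .
  qed auto
  then have indep: "P.indep_vars (\<lambda>_. borel) (\<lambda>j w. \<phi> (w j)) J"
    by (rule P.indep_vars_compose2) auto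
  have ex: "P.expectation (\<lambda>w. \<phi> (w j)) = (\<integral>z. \<phi> z \<partial>D)" if "j \<in> J" for j
  proof -
    have "(\<integral>z. \<phi> z \<partial>distr ?P D (\<lambda>w. w j)) = P.expectation (\<lambda>w. \<phi> (w j))"
      using that by (intro integral_distr) auto
    then show ?thesis by (simp add: comp[OF that])
  qed
  interpret H: Hoeffding_ineq ?P J "\<lambda>j w. \<phi> (w j)" "\<lambda>_. 0" "\<lambda>_. 1" "card J * (\<integral>z. \<phi> z \<partial>D)"
    by unfold_locales (use J indep bd ex in auto)
  show ?thesis
    using H.Hoeffding_ineq_abs_ge[OF c] J by (simp add: card_gt_0_iff)
qed

text \<open>The evaluation point may belong to the sample that determines the hypothesis. Composing
  joint measurability with the map from \<open>w\<close> to \<open>(restrict w {..<n}, w j)\<close>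
  covers sample points and ghost points alike; \<open>sample n\<close> does not see the
  restriction.\<close>

lemma measurable_sample_dependent:
  assumes F: "(\<lambda>(s, z). g (A (sample n s)) z) \<in> measurable (iid n D \<Otimes>\<^sub>M D) (count_space (UNIV :: bool set))"
    and I: "{..<n} \<subseteq> I" and j: "j \<in> I"
  shows "(\<lambda>w. of_bool (g (A (sample n w)) (w j)) :: real) \<in> borel_measurable (PiM I (\<lambda>_. D))"
proof -
  have "(\<lambda>w. (restrict w {..<n}, w j)) \<in> measurable (PiM I (\<lambda>_. D)) (iid n D \<Otimes>\<^sub>M D)"
    unfolding iid_def using j
    by (intro measurable_Pair measurable_restrict_subset[OF I] measurable_component_singleton)
  from measurable_compose[OF this F]
  have "(\<lambda>w. g (A (sample n (restrict w {..<n}))) (w j))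
      \<in> measurable (PiM I (\<lambda>_. D)) (count_space UNIV)" by simp
  also have "(\<lambda>w. g (A (sample n (restrict w {..<n}))) (w j)) = (\<lambda>w. g (A (sample n w)) (w j))"
  proof
    fix w :: "nat \<Rightarrow> 'a"
    have "sample n (restrict w {..<n}) = sample n w"
      by (rule sample_cong) simp
    then show "g (A (sample n (restrict w {..<n}))) (w j) = g (A (sample n w)) (w j)"
      by simp
  qed
  finally show ?thesis
    by (rule measurable_compose[OF _ borel_measurable_count_space[of of_bool]])
qed

text \<open>Given a sample with deviation above \<open>\<epsilon>\<close>, a fresh half stays within
  \<open>\<epsilon> / 2\<close> of the expectation with probability at least \<open>1 / 2\<close>,
  and then the halves differ by more than \<open>n * \<epsilon> / 2\<close>. The factor 4 combines
  this loss of 2 with the two tails, and the exponent is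
  \<open>n * (\<epsilon> / 2)^2 / 2\<close>.\<close>

lemma compression_generalization:
  fixes D :: "'z measure" and \<epsilon> :: real and n :: nat
  assumes D: "prob_space D"
    and A: "\<And>S. length (A S) \<le> k \<and> set (A S) \<subseteq> set S"
    and F: "(\<lambda>(s, z). g (A (sample n s)) z) \<in> measurable (iid n D \<Otimes>\<^sub>M D) (count_space (UNIV :: bool set))"
    and n: "n \<ge> 1" and \<epsilon>: "\<epsilon> \<ge> 0" "real n * \<epsilon>\<^sup>2 \<ge> 4"
  shows "emeasure (iid n D) {s \<in> space (iid n D).
      \<bar>sample_average n s (g (A (sample n s))) - expected_value D (g (A (sample n s)))\<bar> > \<epsilon>}
    \<le> ennreal (4 * real (\<Sum>i\<le>k. (2 * n) ^ i) * exp (- (real n * \<epsilon>\<^sup>2 / 8)))"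
proof -
  define h where "h s = g (A (sample n s))" for s
  define dev where "dev s = \<bar>sample_average n s (h s) - expected_value D (h s)\<bar>" for s
  define Bad where "Bad = {s \<in> space (iid n D). dev s > \<epsilon>}"
  let ?J = "{n..<2 * n}"
  let ?P = "PiM {..<2 * n} (\<lambda>_. D)" and ?PJ = "PiM ?J (\<lambda>_. D)"
  define W where "W = {w \<in> space ?P. double_dev n (h w) w > real n * (\<epsilon> / 2)}"
  interpret D: prob_space D by fact
  interpret PJ: prob_space ?PJ by (intro prob_space_PiM D)
  interpret S: product_sigma_finite "\<lambda>_. D"
    by (simp add: product_sigma_finite_def D.sigma_finite_measure_axioms)
  have IJ: "{..<n} \<union> ?J = {..<2 * n}" "{..<n} \<inter> ?J = {}" by auto
  have P_meas: "(\<lambda>w. of_bool (h w (w j)) :: real) \<in> borel_measurable ?P" if "j < 2 * n" for j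
    unfolding h_def by (rule measurable_sample_dependent[where g=g and A=A, OF F]) (use that in auto)
  have [measurable]: "(\<lambda>w. double_dev n (h w) w) \<in> borel_measurable ?P"
    unfolding double_dev_def
    by (intro borel_measurable_abs borel_measurable_diff borel_measurable_sum P_meas) auto
  have W: "W \<in> sets ?P"
    unfolding W_def by measurable
  have iid_meas: "(\<lambda>w. of_bool (h w (w j)) :: real) \<in> borel_measurable (iid n D)" if "j < n" for j
    unfolding h_def iid_def by (rule measurable_sample_dependent[where g=g and A=A, OF F]) (use that in auto)
  have F': "(\<lambda>(s, z). of_bool (h s z) :: real) \<in> borel_measurable (iid n D \<Otimes>\<^sub>M D)"
    using measurable_compose[OF F borel_measurable_count_space, of "of_bool :: bool \<Rightarrow> real"]
    by (simp add: h_def case_prod_beta')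
  have [measurable]: "(\<lambda>s. expected_value D (h s)) \<in> borel_measurable (iid n D)"
    unfolding expected_value_def by (rule D.borel_measurable_lebesgue_integral[OF F'])
  have [measurable]: "(\<lambda>s. sample_average n s (h s)) \<in> borel_measurable (iid n D)"
    unfolding sample_average_def by (intro borel_measurable_divide borel_measurable_sum iid_meas) auto
  have Bad: "Bad \<in> sets (iid n D)"
    unfolding Bad_def dev_def by measurable
  have half: "ennreal (1 / 2) \<le> (\<integral>\<^sup>+z. indicator W (merge {..<n} ?J (s, z)) \<partial>?PJ)" if s: "s \<in> Bad" for s
  proof -
    have s': "s \<in> space (iid n D)" using s by (simp add: Bad_def)
    have \<phi>: "(\<lambda>z. of_bool (h s z) :: real) \<in> borel_measurable D"
      using measurable_compose[OF measurable_Pair1'[OF s'] F'] by simp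
    define \<mu> where "\<mu> = expected_value D (h s)"
    \<comment> \<open>With \<open>s\<close> fixed, \<open>h s\<close> does not depend on the ghost
      points, so these are independent trials with mean \<open>\<mu>\<close>; \<open>Z\<close> is
      the event that they deviate.\<close>
    define Z where "Z = {z \<in> space ?PJ.
        \<bar>(\<Sum>j\<in>?J. of_bool (h s (z j))) - real n * \<mu>\<bar> \<ge> real n * (\<epsilon> / 2)}"
    have "measure ?PJ Z \<le> 2 * exp (- 2 * (real n * (\<epsilon> / 2))\<^sup>2 / real n)"
      using Hoeffding_PiM[OF D \<phi>, of ?J "real n * (\<epsilon> / 2)"] n \<epsilon>(1)
      by (simp add: Z_def \<mu>_def expected_value_def del: sum_of_bool_eq)
    also have "- 2 * (real n * (\<epsilon> / 2))\<^sup>2 / real n = - (real n * \<epsilon>\<^sup>2 / 2)"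
      using n by (simp add: power2_eq_square field_simps)
    \<comment> \<open>Here \<open>n * \<epsilon>^2 \<ge> 4\<close> enters: it makes the failure
      probability of the ghost half at most \<open>2 * exp (- 2) \<le> 1 / 2\<close>.\<close>
    also have "2 * exp (- (real n * \<epsilon>\<^sup>2 / 2)) \<le> 2 * exp (- 2 :: real)"
      using \<epsilon>(2) by simp
    also have "\<dots> \<le> 1 / 2"
      using exp_ge_add_one_self[of 1] power_mono[of 2 "exp 1 :: real" 2]
      by (simp add: exp_minus field_simps flip: exp_of_nat_mult exp_double)
    finally have Z: "measure ?PJ Z \<le> 1 / 2" .
    have [measurable]: "Z \<in> sets ?PJ"
    proof -
      have [measurable]: "(\<lambda>z. \<Sum>j\<in>?J. of_bool (h s (z j)) :: real) \<in> borel_measurable ?PJ"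
        by (intro borel_measurable_sum measurable_compose[OF _ \<phi>] measurable_component_singleton)
      show ?thesis
        unfolding Z_def by measurable
    qed
    have sub: "space ?PJ - Z \<subseteq> {z \<in> space ?PJ. merge {..<n} ?J (s, z) \<in> W}"
    proof
      fix z assume z: "z \<in> space ?PJ - Z"
      let ?w = "merge {..<n} ?J (s, z)"
      have w: "?w \<in> space ?P"
        using s' z by (auto simp: space_PiM iid_def merge_def PiE_iff extensional_def)
      have w1: "?w i = s i" if "i < n" for i using that by (simp add: merge_def)
      have w2: "?w i = z i" if "i \<in> ?J" for i using that by (simp add: merge_def)
      have hw: "h ?w = h s"
        unfolding h_def using sample_cong[of n ?w s] w1 by simp
      have "(\<Sum>i<n. of_bool (h s (?w i))) = (\<Sum>i<n. of_bool (h s (s i)) :: real)"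
        by (intro sum.cong) (auto simp: w1)
      moreover have "(\<Sum>i<n. of_bool (h s (?w (n + i)))) = (\<Sum>j\<in>?J. of_bool (h s (z j)) :: real)"
        by (rule sum.reindex_bij_witness[of _ "\<lambda>j. j - n" "\<lambda>i. n + i"]) (auto simp: w2)
      moreover have "\<bar>(\<Sum>j\<in>?J. of_bool (h s (z j))) - real n * \<mu>\<bar> < real n * (\<epsilon> / 2)"
        using z by (auto simp: Z_def)
      moreover have "\<bar>(\<Sum>i<n. of_bool (h s (s i))) - real n * \<mu>\<bar> > real n * \<epsilon>"
      proof -
        have "real n * \<epsilon> < real n * dev s"
          using s n by (simp add: Bad_def)
        also have "\<dots> = \<bar>real n * (sample_average n s (h s) - \<mu>)\<bar>"
          by (simp add: dev_def \<mu>_def abs_mult)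
        also have "real n * (sample_average n s (h s) - \<mu>) = (\<Sum>i<n. of_bool (h s (s i))) - real n * \<mu>"
          using n by (simp add: sample_average_def right_diff_distrib)
        finally show ?thesis .
      qed
      ultimately have "double_dev n (h ?w) ?w > real n * (\<epsilon> / 2)"
        unfolding double_dev_def hw by linarith
      then show "z \<in> {z \<in> space ?PJ. merge {..<n} ?J (s, z) \<in> W}"
        using z w by (simp add: W_def)
    qed
    have mW: "{z \<in> space ?PJ. merge {..<n} ?J (s, z) \<in> W} \<in> sets ?PJ"
    proof -
      have "(\<lambda>z. merge {..<n} ?J (s, z)) \<in> measurable ?PJ (PiM ({..<n} \<union> ?J) (\<lambda>_. D))"
        using s' unfolding iid_def
        by (intro measurable_compose[OF measurable_Pair1' measurable_merge])
      then show ?thesis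
        using W unfolding IJ by measurable
    qed
    have "1 / 2 \<le> measure ?PJ (space ?PJ - Z)"
      using Z by (simp add: PJ.prob_compl)
    also have "\<dots> \<le> measure ?PJ {z \<in> space ?PJ. merge {..<n} ?J (s, z) \<in> W}"
      using sub mW by (rule PJ.finite_measure_mono)
    finally have "ennreal (1 / 2) \<le> emeasure ?PJ {z \<in> space ?PJ. merge {..<n} ?J (s, z) \<in> W}"
      unfolding PJ.emeasure_eq_measure by (rule ennreal_leI)
    also have "\<dots> = (\<integral>\<^sup>+z. indicator {z \<in> space ?PJ. merge {..<n} ?J (s, z) \<in> W} z \<partial>?PJ)"
      using mW by simp
    also have "\<dots> = (\<integral>\<^sup>+z. indicator W (merge {..<n} ?J (s, z)) \<partial>?PJ)"
      by (intro nn_integral_cong) (simp add: indicator_def)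
    finally show ?thesis .
  qed
  have "ennreal (1 / 2) * emeasure (iid n D) Bad = (\<integral>\<^sup>+s. ennreal (1 / 2) * indicator Bad s \<partial>iid n D)"
    using Bad by (simp add: nn_integral_cmult_indicator)
  also have "\<dots> \<le> (\<integral>\<^sup>+s. (\<integral>\<^sup>+z. indicator W (merge {..<n} ?J (s, z)) \<partial>?PJ) \<partial>iid n D)"
    using half by (intro nn_integral_mono) (simp add: indicator_def)
  also have "\<dots> = (\<integral>\<^sup>+w. indicator W w \<partial>PiM ({..<n} \<union> ?J) (\<lambda>_. D))"
    unfolding iid_def using W
    by (intro S.product_nn_integral_fold[symmetric]) (auto simp: IJ)
  also have "\<dots> = emeasure ?P W"
    using W by (simp add: IJ)
  also have "\<dots> \<le> ennreal (real (\<Sum>i\<le>k. (2 * n) ^ i) * (2 * exp (- (real n * (\<epsilon> / 2)\<^sup>2 / 2))))"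
    using symmetrization[OF D A, of "\<epsilon> / 2" n g] W \<epsilon>(1) by (simp add: W_def h_def)
  finally have "ennreal 2 * (ennreal (1 / 2) * emeasure (iid n D) Bad) \<le>
      ennreal 2 * ennreal (real (\<Sum>i\<le>k. (2 * n) ^ i) * (2 * exp (- (real n * (\<epsilon> / 2)\<^sup>2 / 2))))"
    by (rule mult_left_mono) simp
  moreover have "ennreal 2 * (ennreal (1 / 2) * emeasure (iid n D) Bad) = emeasure (iid n D) Bad"
  proof -
    have "ennreal 2 * ennreal (1 / 2) = 1"
      by (subst ennreal_mult[symmetric]) simp_all
    then show ?thesis
      by (simp only: mult.assoc[symmetric] mult_1_left)
  qed
  moreover have "ennreal 2 * ennreal (real (\<Sum>i\<le>k. (2 * n) ^ i) * (2 * exp (- (real n * (\<epsilon> / 2)\<^sup>2 / 2)))) =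
      ennreal (4 * real (\<Sum>i\<le>k. (2 * n) ^ i) * exp (- (real n * \<epsilon>\<^sup>2 / 8)))"
    by (subst ennreal_mult[symmetric]) (auto simp: power_divide mult.assoc intro!: mult_nonneg_nonneg sum_nonneg)
  ultimately show ?thesis
    by (simp add: Bad_def dev_def h_def)
qed

section \<open>Accuracy of the threshold learner\<close>

text \<open>The sections of \<open>R\<close> need not be measurable, hence the measurable subset \<open>B\<close>.\<close>

lemma hit_missed_region:
  fixes D :: "'z measure" and \<epsilon> :: real and n :: nat
  assumes D: "prob_space D" and i: "i < n" and \<epsilon>: "\<epsilon> \<ge> 0" and R: "R \<in> sets (completion (D \<Otimes>\<^sub>M D))"
  shows "\<exists>E\<in>sets (iid n D). measure (iid n D) E \<le> exp (- (\<epsilon> * real (n - 1))) \<and>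
    {s \<in> space (iid n D). (\<exists>B\<in>sets D. B \<subseteq> R `` {s i} \<and> measure D B > \<epsilon>) \<and>
      (\<forall>j<n. (s i, s j) \<notin> R)} \<subseteq> E"
proof -
  interpret D: prob_space D by fact
  interpret DD: pair_prob_space D D ..
  interpret S: product_sigma_finite "\<lambda>_. D"
    by (simp add: product_sigma_finite_def D.sigma_finite_measure_axioms)
  let ?P = "iid n D" and ?I = "{..<n} - {i}"
  interpret P: prob_space ?P unfolding iid_def by (intro prob_space_PiM D)
  have ins: "{..<n} = insert i ?I" using i by auto
  obtain R0 N N' where RN: "R = R0 \<union> N" "N \<subseteq> N'" and N': "N' \<in> null_sets (D \<Otimes>\<^sub>M D)"
    and R0 [measurable]: "R0 \<in> sets (D \<Otimes>\<^sub>M D)"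
    using R by (rule sets_completionE)
  have N'_sets [measurable]: "N' \<in> sets (D \<Otimes>\<^sub>M D)" using N' by auto
  \<comment> \<open>By Fubini almost every section of \<open>N'\<close> is null; the exceptional
    first coordinates lie in the null set \<open>Z\<close>.\<close>
  have "AE x in D. AE y in D. (x, y) \<notin> N'"
    using N' by (intro DD.AE_pair AE_not_in)
  then obtain Z where Z: "{x \<in> space D. \<not> (AE y in D. (x, y) \<notin> N')} \<subseteq> Z" "emeasure D Z = 0" "Z \<in> sets D"
    by (rule AE_E)
  have sec_N: "emeasure D (Pair x -` N') = 0" if "x \<in> space D - Z" for x
  proof -
    have "AE y in D. y \<notin> Pair x -` N'" using that Z by auto
    then have "Pair x -` N' \<in> null_sets D"
      using sets_Pair1[OF N'_sets] by (subst AE_iff_null_sets)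
    then show ?thesis by auto
  qed
  define c where "c x = emeasure D (Pair x -` R0)" for x
  have c_meas [measurable]: "c \<in> borel_measurable D"
    unfolding c_def by (rule D.measurable_emeasure_Pair) simp
  \<comment> \<open>\<open>G\<close> is a measurable substitute for the event, with
    \<open>R0\<close> for \<open>R\<close> and only the points other than \<open>s i\<close>;
    \<open>Y\<close> is the null event that \<open>s i\<close> is exceptional.\<close>
  define G where "G = {s \<in> space ?P. c (s i) > ennreal \<epsilon> \<and> (\<forall>j\<in>?I. (s i, s j) \<notin> R0)}"
  define Y where "Y = {s \<in> space ?P. s i \<in> Z}"
  have comp [measurable]: "(\<lambda>s. s j) \<in> measurable ?P D" if "j < n" for j
    unfolding iid_def using that by (intro measurable_component_singleton) simp
  have [measurable]: "(\<lambda>s. s i) \<in> measurable ?P D" using comp i by blast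
  have G [measurable]: "G \<in> sets ?P"
  proof -
    have [measurable]: "{s \<in> space ?P. (s i, s j) \<notin> R0} \<in> sets ?P" if "j \<in> ?I" for j
    proof -
      have [measurable]: "(\<lambda>s. s j) \<in> measurable ?P D" using comp that by blast
      show ?thesis by measurable
    qed
    have "{s \<in> space ?P. \<forall>j\<in>?I. (s i, s j) \<notin> R0} \<in> sets ?P"
      by (rule sets.sets_Collect_finite_All) auto
    moreover have "{s \<in> space ?P. c (s i) > ennreal \<epsilon>} \<in> sets ?P"
      by measurable
    moreover have "G = {s \<in> space ?P. c (s i) > ennreal \<epsilon>} \<inter> {s \<in> space ?P. \<forall>j\<in>?I. (s i, s j) \<notin> R0}"
      by (auto simp: G_def)
    ultimately show ?thesis by simp
  qed
  have Y [measurable]: "Y \<in> sets ?P"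
    using Z(3) unfolding Y_def by measurable
  have "emeasure ?P Y = emeasure (distr ?P D (\<lambda>s. s i)) Z"
    using Z(3) by (subst emeasure_distr) (auto simp: Y_def intro!: arg_cong[where f="emeasure ?P"])
  also have "distr ?P D (\<lambda>s. s i) = D"
    unfolding iid_def using D i by (intro distr_PiM_component) auto
  finally have Y0: "Y \<in> null_sets ?P" using Z by (simp add: null_sets_def Y)
  have "emeasure ?P G = (\<integral>\<^sup>+s. indicator G s \<partial>PiM (insert i ?I) (\<lambda>_. D))"
    using G unfolding iid_def ins[symmetric] by simp
  \<comment> \<open>Coordinate \<open>i\<close> is integrated last: once \<open>s i = y\<close> is
    fixed, the remaining points are independent and each must miss a section of mass above
    \<open>\<epsilon>\<close>.\<close>
  also have "\<dots> = (\<integral>\<^sup>+y. (\<integral>\<^sup>+x. indicator G (x(i := y)) \<partial>PiM ?I (\<lambda>_. D)) \<partial>D)"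
    using G unfolding iid_def by (intro S.product_nn_integral_insert_rev) (use i in \<open>auto simp: insert_absorb\<close>)
  also have "\<dots> \<le> (\<integral>\<^sup>+y. ennreal (exp (- (\<epsilon> * real (n - 1)))) \<partial>D)"
  proof (rule nn_integral_mono)
    fix y assume y: "y \<in> space D"
    let ?B = "space D - Pair y -` R0"
    have yR: "Pair y -` R0 \<in> sets D" by measurable
    show "(\<integral>\<^sup>+x. indicator G (x(i := y)) \<partial>PiM ?I (\<lambda>_. D)) \<le> ennreal (exp (- (\<epsilon> * real (n - 1))))"
    proof (cases "c y > ennreal \<epsilon>")
      case False
      then have "indicator G (x(i := y)) = (0 :: ennreal)" for x
        by (simp add: G_def indicator_def)
      then show ?thesis by simp
    next
      case True
      have "(\<integral>\<^sup>+x. indicator G (x(i := y)) \<partial>PiM ?I (\<lambda>_. D))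
          \<le> (\<integral>\<^sup>+x. indicator (PiE ?I (\<lambda>_. ?B)) x \<partial>PiM ?I (\<lambda>_. D))"
        by (intro nn_integral_mono) (auto simp: G_def indicator_def space_PiM PiE_iff)
      also have "\<dots> = emeasure (PiM ?I (\<lambda>_. D)) (PiE ?I (\<lambda>_. ?B))"
        using yR by (intro nn_integral_indicator sets_PiM_I_finite) auto
      also have "\<dots> = (\<Prod>j\<in>?I. emeasure D ?B)"
        using yR by (intro S.emeasure_PiM) auto
      \<comment> \<open>Only \<open>n - 1\<close> factors occur, since \<open>s i\<close> was spent
        on fixing the section.\<close>
      also have "\<dots> = emeasure D ?B ^ (n - 1)"
        using i by simp
      also have "emeasure D ?B = ennreal (1 - measure D (Pair y -` R0))"
        using yR by (simp add: D.emeasure_eq_measure D.prob_compl)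
      also have "\<dots> ^ (n - 1) = ennreal ((1 - measure D (Pair y -` R0)) ^ (n - 1))"
        by (simp add: ennreal_power)
      also have "\<dots> \<le> ennreal (exp (- \<epsilon>) ^ (n - 1))"
      proof (intro ennreal_leI power_mono)
        have "\<epsilon> \<le> measure D (Pair y -` R0)"
          using True \<epsilon> by (simp add: c_def D.emeasure_eq_measure ennreal_less_iff)
        then show "1 - measure D (Pair y -` R0) \<le> exp (- \<epsilon>)"
          using exp_ge_add_one_self[of "- \<epsilon>"] by simp
      qed simp
      also have "exp (- \<epsilon>) ^ (n - 1) = exp (- (\<epsilon> * real (n - 1)))"
        by (simp flip: exp_of_nat_mult add: mult.commute)
      finally show ?thesis .
    qed
  qed
  also have "\<dots> = ennreal (exp (- (\<epsilon> * real (n - 1))))"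
    by (simp add: D.emeasure_space_1)
  finally have mG: "emeasure ?P G \<le> ennreal (exp (- (\<epsilon> * real (n - 1))))" .
  have "emeasure ?P (G \<union> Y) = emeasure ?P G"
    by (rule emeasure_Un_null_set) (use G Y0 in auto)
  then have 1: "measure ?P (G \<union> Y) \<le> exp (- (\<epsilon> * real (n - 1)))"
    using mG by (simp add: P.emeasure_eq_measure)
  have 2: "{s \<in> space ?P. (\<exists>B\<in>sets D. B \<subseteq> R `` {s i} \<and> measure D B > \<epsilon>) \<and>
      (\<forall>j<n. (s i, s j) \<notin> R)} \<subseteq> G \<union> Y"
  proof clarify
    fix s B assume s: "s \<in> space ?P" and B: "B \<in> sets D" "B \<subseteq> R `` {s i}"
      and m: "measure D B > \<epsilon>" and mis: "\<forall>j<n. (s i, s j) \<notin> R" and "s \<notin> Y"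
    then have si: "s i \<in> space D - Z"
      using i by (auto simp: Y_def iid_def space_PiM)
    have "B \<subseteq> (Pair (s i) -` R0) \<union> (Pair (s i) -` N')"
      using B RN by auto
    then have "emeasure D (B) \<le> emeasure D ((Pair (s i) -` R0) \<union> (Pair (s i) -` N'))"
      by (intro emeasure_mono) auto
    also have "\<dots> \<le> c (s i) + emeasure D (Pair (s i) -` N')"
      unfolding c_def by (intro emeasure_subadditive) auto
    also have "\<dots> = c (s i)" by (simp add: sec_N[OF si])
    finally have "emeasure D (B) \<le> c (s i)" .
    moreover have "ennreal \<epsilon> < ennreal (measure D (B))"
      using m \<epsilon> by (simp add: ennreal_less_iff)
    ultimately have "c (s i) > ennreal \<epsilon>"
      by (simp add: D.emeasure_eq_measure)
    then show "s \<in> G"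
      using s mis RN by (auto simp: G_def)
  qed
  show ?thesis
    using 1 2 G Y by (intro bexI[of _ "G \<union> Y"]) auto
qed

text \<open>Exchanging the coordinates preserves the product measure, so it maps measurable sets to
  measurable sets and null sets to null sets. This supplies the relation \<open>x < y\<close>, as
  the complement of a converse.\<close>

lemma sets_completion_converse:
  assumes M: "prob_space M" "space M = UNIV" and R: "R \<in> sets (completion (M \<Otimes>\<^sub>M M))"
  shows "R\<inverse> \<in> sets (completion (M \<Otimes>\<^sub>M M))"
proof -
  interpret M: prob_space M by fact
  interpret MM: pair_prob_space M M ..
  have conv: "S\<inverse> \<in> sets (M \<Otimes>\<^sub>M M)" "emeasure (M \<Otimes>\<^sub>M M) (S\<inverse>) = emeasure (M \<Otimes>\<^sub>M M) S"
    if S: "S \<in> sets (M \<Otimes>\<^sub>M M)" for S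
  proof -
    have eq: "(\<lambda>(x, y). (y, x)) -` S \<inter> space (M \<Otimes>\<^sub>M M) = S\<inverse>"
      by (auto simp: space_pair_measure M(2))
    show "S\<inverse> \<in> sets (M \<Otimes>\<^sub>M M)"
      using measurable_sets[OF measurable_pair_swap' S] unfolding eq .
    have "emeasure (M \<Otimes>\<^sub>M M) S = emeasure (distr (M \<Otimes>\<^sub>M M) (M \<Otimes>\<^sub>M M) (\<lambda>(x, y). (y, x))) S"
      using MM.distr_pair_swap by simp
    also have "\<dots> = emeasure (M \<Otimes>\<^sub>M M) (S\<inverse>)"
      unfolding emeasure_distr[OF measurable_pair_swap' S] eq ..
    finally show "emeasure (M \<Otimes>\<^sub>M M) (S\<inverse>) = emeasure (M \<Otimes>\<^sub>M M) S" ..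
  qed
  obtain S N N' where *: "R = S \<union> N" "N \<subseteq> N'" "N' \<in> null_sets (M \<Otimes>\<^sub>M M)" "S \<in> sets (M \<Otimes>\<^sub>M M)"
    using R by (rule sets_completionE)
  show ?thesis
  proof (rule sets_completionI)
    show "R\<inverse> = S\<inverse> \<union> N\<inverse>" "N\<inverse> \<subseteq> N'\<inverse>" using * by auto
    show "N'\<inverse> \<in> null_sets (M \<Otimes>\<^sub>M M)" using *(3) conv[of N'] by (simp add: null_sets_def)
    show "S\<inverse> \<in> sets (M \<Otimes>\<^sub>M M)" using * conv by simp
  qed
qed

section \<open>The compression scheme for thresholds\<close>

text \<open>The second example of a two-element list is only a marker: the threshold lies strictly below
  the first one. This is needed when all labels are negative.\<close>

fun decode :: "('a::linorder \<times> bool) list \<Rightarrow> 'a \<Rightarrow> bool" where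
  "decode [] = threshold undefined"
| "decode [p] = threshold (fst p)"
| "decode (p # _ # _) = threshold (SOME y. y < fst p)"

text \<open>Repeating \<open>p\<close> encodes the marker with sample points only. As
  \<open>p\<close> is minimal, any threshold strictly below it rejects the whole sample, and
  requiring some \<open>y\<close> below it makes the choice in \<open>decode\<close>
  meaningful.\<close>

definition candidate :: "('a::linorder \<times> bool) list \<Rightarrow> ('a \<times> bool) list \<Rightarrow> bool" where
  "candidate S T \<longleftrightarrow> (S = [] \<and> T = []) \<or> (\<exists>p\<in>set S. T = [p]) \<or>
     (\<exists>p\<in>set S. T = [p, p] \<and> (\<forall>r\<in>set S. fst p \<le> fst r) \<and> (\<exists>y. y < fst p))"

definition encode :: "('a::linorder \<times> bool) list \<Rightarrow> ('a \<times> bool) list" where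
  "encode S = (SOME T. candidate S T \<and> is_erm threshold_class S (decode T))"

lemma decode_in_threshold_class: "decode T \<in> threshold_class"
  by (cases T rule: decode.cases) (auto simp: threshold_class_def)

lemma emp_err_cong: "(\<And>p. p \<in> set S \<Longrightarrow> h (fst p) = h' (fst p)) \<Longrightarrow> emp_err h S = emp_err h' S"
  unfolding emp_err_def by (intro arg_cong2[where f="(/)"] arg_cong[where f=real]
    arg_cong[where f=length] filter_cong) auto

text \<open>On the sample, \<open>threshold x\<close> acts like the threshold at the largest sample
  point not above \<open>x\<close>. If there is no such point it rejects the entire sample, as does
  any threshold below the smallest point, and \<open>x\<close> itself shows that one exists.\<close>

lemma candidate_cover:
  "\<exists>T. candidate S T \<and> emp_err (decode T) S = emp_err (threshold x) S"
proof -
  let ?P = "{p \<in> set S. fst p \<le> x}"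
  consider "S = []" | "?P \<noteq> {}" | "S \<noteq> []" "?P = {}" by blast
  then show ?thesis
  proof cases
    case 1
    then show ?thesis by (auto simp: candidate_def emp_err_def)
  next
    case 2
    have fin: "finite (fst ` ?P)" by simp
    have "Max (fst ` ?P) \<in> fst ` ?P" using 2 fin by (intro Max_in) auto
    then obtain p where p: "p \<in> ?P" "Max (fst ` ?P) = fst p" by blast
    have "fst r \<le> fst p" if "r \<in> ?P" for r
      using Max_ge[OF fin imageI[OF that]] by (simp only: p(2))
    then have "emp_err (decode [p]) S = emp_err (threshold x) S"
      using p(1) by (intro emp_err_cong) (auto simp: threshold_def)
    then show ?thesis using p(1) by (auto simp: candidate_def)
  next
    case 3
    have fin: "finite (fst ` set S)" by simp
    have "Min (fst ` set S) \<in> fst ` set S" using 3(1) fin by (intro Min_in) auto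
    then obtain p where p: "p \<in> set S" "Min (fst ` set S) = fst p" by blast
    have min: "fst p \<le> fst r" if "r \<in> set S" for r
      using Min_le[OF fin imageI[OF that]] by (simp only: p(2))
    have "\<not> fst p \<le> x" using p(1) 3(2) by blast
    then have x: "x < fst p" by simp
    then have "(SOME y. y < fst p) < fst p" by (rule someI)
    then have "emp_err (decode [p, p]) S = emp_err (threshold x) S"
      using min x by (intro emp_err_cong) (fastforce simp: threshold_def)
    moreover have "candidate S [p, p]"
      unfolding candidate_def using p(1) min x by blast
    ultimately show ?thesis by blast
  qed
qed

text \<open>The number of mistakes is a natural number, so some candidate minimizes it even if the
  class is infinite; since candidates match the error of every threshold, no threshold does
  better.\<close>

lemma encode_spec: "candidate S (encode S) \<and> is_erm threshold_class S (decode (encode S))"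
proof -
  define m where "m T = length (filter (\<lambda>(x, y). decode T x \<noteq> y) S)" for T
  obtain T where T: "candidate S T" "\<And>T'. candidate S T' \<Longrightarrow> m T \<le> m T'"
    using candidate_cover[of S] ex_has_least_nat[of "candidate S" _ m] by blast
  have "emp_err (decode T) S \<le> emp_err h S" if "h \<in> threshold_class" for h
  proof -
    obtain x where h: "h = threshold x" using \<open>h \<in> threshold_class\<close> by (auto simp: threshold_class_def)
    obtain T' where T': "candidate S T'" "emp_err (decode T') S = emp_err (threshold x) S"
      using candidate_cover by blast
    have "emp_err (decode T) S \<le> emp_err (decode T') S"
      using T(2)[OF T'(1)] by (simp add: emp_err_def m_def divide_right_mono)
    then show ?thesis using T'(2) h by simp
  qed
  then have "candidate S T \<and> is_erm threshold_class S (decode T)"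
    using T(1) decode_in_threshold_class by (auto simp: is_erm_def)
  then show ?thesis unfolding encode_def by (rule someI)
qed

lemma encode_size: "length (encode S) \<le> 2 \<and> set (encode S) \<subseteq> set S"
  using encode_spec[of S] by (auto simp: candidate_def)

lemma compression_learner_encode: "compression_learner threshold_class 2 encode decode"
  using encode_size encode_spec by (auto simp: compression_learner_def)

text \<open>The points separating the target from a threshold at (or just below) \<open>x\<close>, on the side of
  the target on which \<open>x\<close> lies.\<close>

definition between :: "'a::linorder \<Rightarrow> ('a \<times> 'a) set" where
  "between t = {(x, y). x < y \<and> y \<le> t} \<union> {(x, y). t < y \<and> y < x}"

text \<open>The target makes no mistakes, so the minimizer \<open>h\<close> agrees with all labels.
  A kept point \<open>xs i\<close> is then at most \<open>t\<close>, and the disagreement is the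
  sample-free interval from \<open>xs i\<close> to \<open>t\<close>. With a marker all sample points
  exceed \<open>t\<close>; the threshold chosen below the smallest one errs only at or below
  \<open>t\<close>, or only between \<open>t\<close> and that point.\<close>

lemma decode_encode_error:
  fixes t :: "'a::linorder" and xs :: "nat \<Rightarrow> 'a" and n :: nat
  assumes n: "n \<ge> 1"
  defines "h \<equiv> decode (encode (sample n (\<lambda>i. (xs i, threshold t (xs i)))))"
  obtains i where "i < n" "{y. h y \<noteq> threshold t y} \<subseteq> between t `` {xs i}" "\<And>j. j < n \<Longrightarrow> (xs i, xs j) \<notin> between t"
  | "{y. h y \<noteq> threshold t y} \<subseteq> {..t}" "\<And>j. j < n \<Longrightarrow> xs j \<notin> {..t}"
proof -
  define S where "S = sample n (\<lambda>i. (xs i, threshold t (xs i)))"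
  have setS: "set S = (\<lambda>i. (xs i, threshold t (xs i))) ` {..<n}"
    by (simp add: S_def sample_def atLeast0LessThan)
  have lenS: "length S = n" by (simp add: S_def sample_def)
  have "emp_err h S \<le> emp_err (threshold t) S"
    using encode_spec[of S] by (auto simp: is_erm_def h_def S_def threshold_class_def)
  also have "\<dots> = 0"
    using setS by (auto simp: emp_err_def filter_empty_conv)
  \<comment> \<open>\<open>n \<ge> 1\<close> excludes division by zero, so an error of at most
    \<open>0\<close> means that there are no mistakes.\<close>
  finally have "filter (\<lambda>(x, y). h x \<noteq> y) S = []"
    using n by (simp add: emp_err_def lenS divide_le_0_iff)
  then have cons: "h (xs j) = threshold t (xs j)" if "j < n" for j
    using that setS by (auto simp: filter_empty_conv)
  have "S \<noteq> []" using n lenS by auto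
  then consider i where "i < n" "encode S = [(xs i, threshold t (xs i))]"
    | i where "i < n" "encode S = [(xs i, threshold t (xs i)), (xs i, threshold t (xs i))]"
        "\<And>j. j < n \<Longrightarrow> xs i \<le> xs j" "\<exists>y. y < xs i"
    using encode_spec[of S] unfolding candidate_def setS by auto
  then show thesis
  proof cases
    case (1 i)
    then have h: "h = threshold (xs i)" by (simp add: h_def S_def)
    have "xs i \<le> t" using cons[OF 1(1)] by (simp add: h threshold_def)
    then have eq: "between t `` {xs i} = {y. h y \<noteq> threshold t y}"
      by (auto simp: between_def h threshold_def)
    then have "(xs i, xs j) \<notin> between t" if "j < n" for j
      using cons[OF that] by blast
    then show thesis using that(1)[OF 1(1)] eq by blast
  next
    case (2 i)
    define y0 where "y0 = (SOME y. y < xs i)"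
    have y0: "y0 < xs i" unfolding y0_def using 2(4) by (rule someI_ex)
    have h: "h = threshold y0" using 2(2) by (simp add: h_def S_def y0_def)
    have gt: "t < xs j" if "j < n" for j
      using cons[OF that] 2(3)[OF that] y0 by (auto simp: h threshold_def)
    show thesis
    proof (cases "y0 \<le> t")
      case True
      then show thesis
        using gt by (intro that(2)) (auto simp: h threshold_def not_le)
    next
      case False
      then have "{y. h y \<noteq> threshold t y} \<subseteq> between t `` {xs i}"
        using y0 by (auto simp: h threshold_def between_def)
      moreover have "(xs i, xs j) \<notin> between t" if "j < n" for j
        using 2(3)[OF that] gt[OF that] by (auto simp: between_def)
      ultimately show thesis using that(1)[OF 2(1)] by blast
    qed
  qed
qed

lemma accurate_decode_encode:
  assumes n: "n \<ge> 1" and \<epsilon>: "\<epsilon> \<ge> 0" and \<delta>: "real (n + 1) * exp (- (\<epsilon> * real (n - 1))) \<le> \<delta>"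
  shows "accurate (threshold_class :: ('a::linorder \<Rightarrow> bool) set) n \<epsilon> \<delta> (decode \<circ> encode)"
  unfolding accurate_def
proof (intro allI ballI impI)
  fix D :: "'a measure" and hstar :: "'a \<Rightarrow> bool"
  assume "hstar \<in> threshold_class" and "order_distribution D"
  then obtain t :: 'a where hstar: "hstar = threshold t" and D: "prob_space D" and sp: "space D = UNIV"
    and atMost [measurable]: "\<And>x. {..x} \<in> sets D"
    and le: "{(x, y). x \<le> y} \<in> sets (completion (D \<Otimes>\<^sub>M D))"
    by (auto simp: threshold_class_def order_distribution_def)
  let ?P = "iid n D"
  let ?C = "completion (D \<Otimes>\<^sub>M D)"
  interpret D: prob_space D by fact
  interpret P: prob_space ?P unfolding iid_def by (intro prob_space_PiM D)
  have spC: "space ?C = UNIV" by (simp add: space_pair_measure sp)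
  \<comment> \<open>The complements of \<open>\<le>\<close> and of its converse are the two strict
    orders; each is cut at \<open>t\<close> in the second coordinate.\<close>
  have between: "between t \<in> sets ?C"
  proof -
    have "UNIV - {(x, y). x \<le> y} \<in> sets ?C"
      using sets.compl_sets[OF le] unfolding spC .
    moreover have "UNIV - {(x, y). x \<le> y}\<inverse> \<in> sets ?C"
      using sets.compl_sets[OF sets_completion_converse[OF D sp le]] unfolding spC .
    moreover have "UNIV \<times> {..t} \<in> sets ?C" "UNIV \<times> (UNIV - {..t}) \<in> sets ?C"
      using atMost[of t] sets.top[of D] unfolding sp by (auto intro!: sets_completionI_sets)
    moreover have "between t = (UNIV - {(x, y). x \<le> y}\<inverse>) \<inter> UNIV \<times> {..t} \<union>
        (UNIV - {(x, y). x \<le> y}) \<inter> UNIV \<times> (UNIV - {..t})"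
      by (auto simp: between_def)
    ultimately show ?thesis by auto
  qed
  have low: "UNIV \<times> {..t} \<in> sets ?C"
    using atMost[of t] sets.top[of D] unfolding sp by (auto intro!: sets_completionI_sets)
  let ?bad = "\<lambda>R i. {s \<in> space ?P. (\<exists>B\<in>sets D. B \<subseteq> R `` {s i} \<and> measure D B > \<epsilon>) \<and>
      (\<forall>j<n. (s i, s j) \<notin> R)}"
  let ?q = "exp (- (\<epsilon> * real (n - 1)))"
  have "\<forall>i\<in>{..<n}. \<exists>E. E \<in> sets ?P \<and> measure ?P E \<le> ?q \<and> ?bad (between t) i \<subseteq> E"
    using hit_missed_region[OF D _ \<epsilon> between] by (simp add: Bex_def)
  from bchoice[OF this] obtain E where
    "\<forall>i\<in>{..<n}. E i \<in> sets ?P \<and> measure ?P (E i) \<le> ?q \<and> ?bad (between t) i \<subseteq> E i" ..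
  then have E: "\<And>i. i < n \<Longrightarrow> E i \<in> sets ?P"
    "\<And>i. i < n \<Longrightarrow> measure ?P (E i) \<le> ?q" "\<And>i. i < n \<Longrightarrow> ?bad (between t) i \<subseteq> E i"
    by (simp_all only: lessThan_iff)
  \<comment> \<open>The region below the target is fixed. Written as
    \<open>UNIV \<times> {..t}\<close> it has the same section everywhere, so index \<open>0\<close>
    serves as anchor, available since \<open>n \<ge> 1\<close>.\<close>
  obtain E0 where E0: "E0 \<in> sets ?P" "measure ?P E0 \<le> ?q" "?bad (UNIV \<times> {..t}) 0 \<subseteq> E0"
    using hit_missed_region[OF D _ \<epsilon> low, where n=n and i=0] n by auto
  let ?E = "E0 \<union> (\<Union>i<n. E i)"
  have sets: "?E \<in> sets ?P" "(\<Union>i<n. E i) \<in> sets ?P" using E(1) E0(1) by auto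
  have "measure ?P ?E \<le> measure ?P E0 + measure ?P (\<Union>i<n. E i)"
    using E0(1) sets(2) by (intro measure_Un_le)
  also have "measure ?P (\<Union>i<n. E i) \<le> (\<Sum>i<n. measure ?P (E i))"
    using E(1) by (intro measure_UNION_le) auto
  also have "\<dots> \<le> (\<Sum>i<n. ?q)"
    using E(2) by (intro sum_mono) auto
  also have "measure ?P E0 + (\<Sum>i<n. ?q) \<le> \<delta>"
    using E0(2) \<delta> unfolding sum_constant card_lessThan of_nat_add of_nat_1 distrib_right by linarith
  finally have "measure ?P ?E \<le> \<delta>" by simp
  show "prob_at_least ?P (1 - \<delta>)
     (\<lambda>xs. (decode \<circ> encode) (sample n (\<lambda>i. (xs i, hstar (xs i)))) \<in> threshold_class \<and>
           err D hstar ((decode \<circ> encode) (sample n (\<lambda>i. (xs i, hstar (xs i))))) \<le> \<epsilon>)"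
    unfolding prob_at_least_def
  proof (intro bexI[of _ "space ?P - ?E"] conjI subsetI CollectI)
    show "1 - \<delta> \<le> measure ?P (space ?P - ?E)"
      using \<open>measure ?P ?E \<le> \<delta>\<close> sets(1) by (simp add: P.prob_compl)
    show "space ?P - ?E \<in> sets ?P" using sets(1) by auto
  next
    fix xs assume xs: "xs \<in> space ?P - ?E"
    then show "xs \<in> space ?P" by simp
    define h where "h = decode (encode (sample n (\<lambda>i. (xs i, threshold t (xs i)))))"
    show "(decode \<circ> encode) (sample n (\<lambda>i. (xs i, hstar (xs i)))) \<in> threshold_class"
      by (simp add: decode_in_threshold_class)
    obtain x where "h = threshold x"
      using decode_in_threshold_class unfolding h_def threshold_class_def by blast
    then have "{y. h y \<noteq> threshold t y} = ({..x} - {..t}) \<union> ({..t} - {..x})"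
      by (auto simp: threshold_def)
    then have B: "{y. h y \<noteq> threshold t y} \<in> sets D"
      using atMost by simp
    have "\<not> measure D {y. h y \<noteq> threshold t y} > \<epsilon>"
    proof
      assume gt: "measure D {y. h y \<noteq> threshold t y} > \<epsilon>"
      from n show False
      proof (rule decode_encode_error[of n xs t, folded h_def])
        fix i assume "i < n" "{y. h y \<noteq> threshold t y} \<subseteq> between t `` {xs i}"
          "\<And>j. j < n \<Longrightarrow> (xs i, xs j) \<notin> between t"
        then have "xs \<in> ?bad (between t) i" using xs B gt by blast
        then show False using E(3)[OF \<open>i < n\<close>] xs \<open>i < n\<close> by blast
      next
        assume "{y. h y \<noteq> threshold t y} \<subseteq> {..t}" "\<And>j. j < n \<Longrightarrow> xs j \<notin> {..t}"
        then have "xs \<in> ?bad (UNIV \<times> {..t}) 0" using xs B gt by blast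
        then show False using E0(3) xs by blast
      qed
    qed
    then show "err D hstar ((decode \<circ> encode) (sample n (\<lambda>i. (xs i, hstar (xs i))))) \<le> \<epsilon>"
      by (simp add: err_def hstar h_def sp)
  qed
qed

section \<open>Robust generalization\<close>

text \<open>With the seed fixed, decoder and adversary together are a deterministic map from
  compressed lists to hypotheses, so the generalization bound for compression applies. A joint
  failure probability of \<open>(\<delta> / 2)^2\<close> is what Markov's inequality needs to leave
  \<open>\<delta> / 2\<close> each for sample and seed.\<close>

lemma robustly_generalizing_compression:
  fixes n :: nat
  assumes A: "\<And>S. length (A S) \<le> k \<and> set (A S) \<subseteq> set S"
    and n: "n \<ge> 1" and \<epsilon>: "\<epsilon> \<ge> 0" "real n * \<epsilon>\<^sup>2 \<ge> 4" and \<delta>: "\<delta> > 0"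
      "4 * real (\<Sum>i\<le>k. (2 * n) ^ i) * exp (- (real n * \<epsilon>\<^sup>2 / 8)) \<le> (\<delta> / 2)\<^sup>2"
  shows "robustly_generalizing n \<epsilon> \<delta> (B \<circ> A)"
  unfolding robustly_generalizing_def
\<comment> \<open>The witness \<open>\<delta> / 2\<close> is used for both \<open>\<zeta>\<close>
  and \<open>\<gamma>\<close>.\<close>
proof (intro exI[of _ "\<delta> / 2"] conjI allI impI)
  fix D :: "('a \<times> bool) measure" and Q :: "real measure" and Adv
  assume asm: "prob_space D \<and> space D = UNIV \<and> adversary n (B \<circ> A) D Q Adv"
  then have D: "prob_space D" and Q: "prob_space Q" by (auto simp: adversary_def)
  have F: "(\<lambda>(s, \<omega>, z). Adv (B (A (sample n s))) \<omega> z)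
      \<in> measurable (iid n D \<Otimes>\<^sub>M (Q \<Otimes>\<^sub>M D)) (count_space UNIV)"
    using asm by (simp add: adversary_def)
  let ?P = "iid n D"
  interpret D: prob_space D by fact
  interpret Q: prob_space Q by fact
  interpret P: prob_space ?P unfolding iid_def by (intro prob_space_PiM D)
  interpret PQ: pair_prob_space ?P Q ..
  define H where "H s \<omega> = Adv (B (A (sample n s))) \<omega>" for s \<omega>
  have F1: "(\<lambda>(s, \<omega>, z). of_bool (H s \<omega> z) :: real) \<in> borel_measurable (?P \<Otimes>\<^sub>M (Q \<Otimes>\<^sub>M D))"
    using measurable_compose[OF F borel_measurable_count_space, of "of_bool :: bool \<Rightarrow> real"]
    by (simp add: H_def case_prod_beta')
  have [measurable]: "(\<lambda>x. expected_value D (H (fst x) (snd x))) \<in> borel_measurable (?P \<Otimes>\<^sub>M Q)"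
    unfolding expected_value_def
  proof (rule D.borel_measurable_lebesgue_integral)
    have "(\<lambda>x. (fst (fst x), snd (fst x), snd x)) \<in> measurable ((?P \<Otimes>\<^sub>M Q) \<Otimes>\<^sub>M D) (?P \<Otimes>\<^sub>M (Q \<Otimes>\<^sub>M D))"
      by measurable
    from measurable_compose[OF this F1]
    show "(\<lambda>(x, z). of_bool (H (fst x) (snd x) z) :: real) \<in> borel_measurable ((?P \<Otimes>\<^sub>M Q) \<Otimes>\<^sub>M D)"
      by (simp add: case_prod_beta')
  qed
  have comp: "(\<lambda>s. s j) \<in> measurable ?P D" if "j < n" for j
    unfolding iid_def using that by (intro measurable_component_singleton) simp
  have term_meas: "(\<lambda>x. of_bool (H (fst x) (snd x) (fst x j)) :: real) \<in> borel_measurable (?P \<Otimes>\<^sub>M Q)"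
    if "j < n" for j
  proof -
    have [measurable]: "(\<lambda>s. s j) \<in> measurable ?P D" using comp[OF that] .
    have "(\<lambda>x. (fst x, snd x, fst x j)) \<in> measurable (?P \<Otimes>\<^sub>M Q) (?P \<Otimes>\<^sub>M (Q \<Otimes>\<^sub>M D))"
      by measurable
    from measurable_compose[OF this F1] show ?thesis by simp
  qed
  have [measurable]: "(\<lambda>x. sample_average n (fst x) (H (fst x) (snd x))) \<in> borel_measurable (?P \<Otimes>\<^sub>M Q)"
    unfolding sample_average_def by (intro borel_measurable_divide borel_measurable_sum term_meas) auto
  define Bad where "Bad = {x \<in> space (?P \<Otimes>\<^sub>M Q).
      \<bar>sample_average n (fst x) (H (fst x) (snd x)) - expected_value D (H (fst x) (snd x))\<bar> > \<epsilon>}"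
  have Bad [measurable]: "Bad \<in> sets (?P \<Otimes>\<^sub>M Q)"
    unfolding Bad_def by measurable
  have sec: "emeasure ?P ((\<lambda>s. (s, \<omega>)) -` Bad) \<le> ennreal ((\<delta> / 2)\<^sup>2)" if \<omega>: "\<omega> \<in> space Q" for \<omega>
  proof -
    have "(\<lambda>x. (fst x, \<omega>, snd x)) \<in> measurable (?P \<Otimes>\<^sub>M D) (?P \<Otimes>\<^sub>M (Q \<Otimes>\<^sub>M D))"
      using \<omega> by measurable
    from measurable_compose[OF this F]
    have F\<omega>: "(\<lambda>(s, z). Adv (B (A (sample n s))) \<omega> z) \<in> measurable (?P \<Otimes>\<^sub>M D) (count_space UNIV)"
      by (simp add: case_prod_beta')
    have "(\<lambda>s. (s, \<omega>)) -` Bad = {s \<in> space ?P.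
        \<bar>sample_average n s (H s \<omega>) - expected_value D (H s \<omega>)\<bar> > \<epsilon>}"
      using \<omega> by (auto simp: Bad_def space_pair_measure)
    then have "emeasure ?P ((\<lambda>s. (s, \<omega>)) -` Bad)
        \<le> ennreal (4 * real (\<Sum>i\<le>k. (2 * n) ^ i) * exp (- (real n * \<epsilon>\<^sup>2 / 8)))"
      using compression_generalization[where g="\<lambda>T. Adv (B T) \<omega>", OF D A F\<omega> n \<epsilon>]
      by (simp only: H_def)
    also have "\<dots> \<le> ennreal ((\<delta> / 2)\<^sup>2)" using \<delta>(2) by (rule ennreal_leI)
    finally show ?thesis .
  qed
  have "emeasure (?P \<Otimes>\<^sub>M Q) Bad = (\<integral>\<^sup>+\<omega>. emeasure ?P ((\<lambda>s. (s, \<omega>)) -` Bad) \<partial>Q)"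
    using Bad by (rule PQ.emeasure_pair_measure_alt2)
  also have "\<dots> \<le> (\<integral>\<^sup>+\<omega>. ennreal ((\<delta> / 2)\<^sup>2) \<partial>Q)"
    using sec by (intro nn_integral_mono)
  also have "\<dots> = ennreal ((\<delta> / 2)\<^sup>2)" by (simp add: Q.emeasure_space_1)
  finally have total: "emeasure (?P \<Otimes>\<^sub>M Q) Bad \<le> ennreal ((\<delta> / 2)\<^sup>2)" .
  define c where "c s = emeasure Q (Pair s -` Bad)" for s
  have [measurable]: "c \<in> borel_measurable ?P"
    unfolding c_def by (rule Q.measurable_emeasure_Pair) (rule Bad)
  define V where "V = {s \<in> space ?P. c s > ennreal (\<delta> / 2)}"
  have V: "V \<in> sets ?P" unfolding V_def by measurable
  \<comment> \<open>Markov's inequality: \<open>c s\<close> is the failure probability over the seed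
    for the sample \<open>s\<close>, and its mean is the joint failure probability.\<close>
  have "ennreal (\<delta> / 2) * emeasure ?P V = (\<integral>\<^sup>+s. ennreal (\<delta> / 2) * indicator V s \<partial>?P)"
    using V by (simp add: nn_integral_cmult_indicator)
  also have "\<dots> \<le> (\<integral>\<^sup>+s. c s \<partial>?P)"
    by (intro nn_integral_mono) (auto simp: V_def indicator_def)
  also have "\<dots> = emeasure (?P \<Otimes>\<^sub>M Q) Bad"
    unfolding c_def using Bad by (rule Q.emeasure_pair_measure_alt[symmetric])
  also note total
  finally have "ennreal (\<delta> / 2) * ennreal (measure ?P V) \<le> ennreal ((\<delta> / 2)\<^sup>2)"
    by (simp only: P.emeasure_eq_measure)
  also have "ennreal (\<delta> / 2) * ennreal (measure ?P V) = ennreal (\<delta> / 2 * measure ?P V)"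
    using \<delta>(1) by (intro ennreal_mult[symmetric]) auto
  finally have "\<delta> / 2 * measure ?P V \<le> \<delta> / 2 * (\<delta> / 2)"
    unfolding power2_eq_square using \<delta>(1) by (subst (asm) ennreal_le_iff) auto
  then have mV: "measure ?P V \<le> \<delta> / 2"
    using \<delta>(1) by (subst (asm) mult_le_cancel_left_pos) auto
  show "prob_at_least ?P (1 - \<delta> / 2) (\<lambda>s. prob_at_least Q (1 - \<delta> / 2)
      (\<lambda>\<omega>. let h = Adv ((B \<circ> A) (sample n s)) \<omega>
           in \<bar>sample_average n s h - expected_value D h\<bar> \<le> \<epsilon>))"
    unfolding prob_at_least_def[of ?P]
  proof (intro bexI[of _ "space ?P - V"] conjI subsetI CollectI)
    show "1 - \<delta> / 2 \<le> measure ?P (space ?P - V)"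
      using mV V by (simp add: P.prob_compl)
    show "space ?P - V \<in> sets ?P" using V by auto
  next
    fix s assume s: "s \<in> space ?P - V"
    then show "s \<in> space ?P" by simp
    have sB: "Pair s -` Bad \<in> sets Q" using Bad by (rule sets_Pair1)
    have "c s \<le> ennreal (\<delta> / 2)" using s by (auto simp: V_def not_less)
    then have m: "measure Q (Pair s -` Bad) \<le> \<delta> / 2"
      using \<delta>(1) by (simp add: c_def Q.emeasure_eq_measure)
    show "prob_at_least Q (1 - \<delta> / 2) (\<lambda>\<omega>. let h = Adv ((B \<circ> A) (sample n s)) \<omega>
           in \<bar>sample_average n s h - expected_value D h\<bar> \<le> \<epsilon>)"
      unfolding prob_at_least_def
    proof (intro bexI[of _ "space Q - Pair s -` Bad"] conjI)
      show "1 - \<delta> / 2 \<le> measure Q (space Q - Pair s -` Bad)"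
        using m sB by (simp add: Q.prob_compl)
      show "space Q - Pair s -` Bad \<in> sets Q" using sB by auto
      show "space Q - Pair s -` Bad \<subseteq> {\<omega> \<in> space Q. let h = Adv ((B \<circ> A) (sample n s)) \<omega>
           in \<bar>sample_average n s h - expected_value D h\<bar> \<le> \<epsilon>}"
        using s by (auto simp: Bad_def space_pair_measure H_def Let_def not_less)
    qed
  qed
qed (use \<delta>(1) in auto)

section \<open>Choice of the constants\<close>

theorem theorem3p12:
  "\<exists>k A B. compression_learner (threshold_class :: ('a::linorder \<Rightarrow> bool) set) k A B \<and>
     (\<exists>C>0. \<forall>(n::nat) (\<delta>::real) (\<epsilon>::real).
        n \<ge> 1 \<and> 0 < \<delta> \<and> \<delta> < 1 \<and> real n \<ge> 8 * ln (2 * real n / \<delta>) \<and>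
        \<epsilon> = C * sqrt (ln (real n / \<delta>) / real n) \<longrightarrow>
        accurate threshold_class n \<epsilon> \<delta> (B \<circ> A) \<and>
        robustly_generalizing n \<epsilon> \<delta> (B \<circ> A))"
\<comment> \<open>The size is 2 because of the marker. The constant 16 is generous: it yields
  \<open>q ^ 8\<close> in the accuracy bound and \<open>q ^ 32\<close> in the generalization
  bound.\<close>
proof (intro exI[of _ "2 :: nat"] exI[of _ encode] exI[of _ decode] exI[of _ "16 :: real"] conjI allI impI)
  show "compression_learner (threshold_class :: ('a \<Rightarrow> bool) set) 2 encode decode"
    by (rule compression_learner_encode)
  show "(0 :: real) < 16" by simp
next
  fix n :: nat and \<delta> \<epsilon> :: real
  assume "n \<ge> 1 \<and> 0 < \<delta> \<and> \<delta> < 1 \<and> real n \<ge> 8 * ln (2 * real n / \<delta>) \<and>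
        \<epsilon> = 16 * sqrt (ln (real n / \<delta>) / real n)"
  then have n1: "n \<ge> 1" and \<delta>: "0 < \<delta>" "\<delta> < 1" and large: "real n \<ge> 8 * ln (2 * real n / \<delta>)"
    and \<epsilon>_def: "\<epsilon> = 16 * sqrt (ln (real n / \<delta>) / real n)" by auto
  \<comment> \<open>With \<open>l = - ln q\<close> the exponentials become powers of
    \<open>q\<close>, which absorb factors of \<open>n\<close> through
    \<open>q * n = \<delta>\<close>.\<close>
  define l where "l = ln (real n / \<delta>)"
  define q where "q = \<delta> / real n"
  have ln2: "ln 2 \<ge> (1 / 2 :: real)"
    using ln_2_less_1 ln2_ge_two_thirds by simp
  have "2 * real n / \<delta> = 2 * (real n / \<delta>)" by simp
  then have "ln (2 * real n / \<delta>) = ln 2 + l"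
    unfolding l_def using n1 \<delta> by (simp only:) (rule ln_mult_pos; simp)
  with large have nl: "real n \<ge> 8 * ln 2 + 8 * l" by simp
  have "real n / \<delta> \<ge> 1" using n1 \<delta> by (simp add: field_simps)
  then have "l \<ge> 0" by (simp add: l_def)
  \<comment> \<open>\<open>8 * ln 2 \<ge> 4\<close> rules out \<open>n = 1\<close>, where the
    accuracy exponent, a multiple of \<open>n - 1\<close>, would vanish.\<close>
  then have n2: "n \<ge> 2" using nl ln2 by linarith
  have "real n / \<delta> \<ge> 2" using n2 \<delta> by (simp add: field_simps)
  then have "ln (real n / \<delta>) \<ge> ln 2" by (intro ln_mono) auto
  then have l: "l \<ge> 1 / 2" using ln2 by (simp add: l_def)
  have q: "q > 0" "q \<le> 1 / 2" "q * real n = \<delta>"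
    using n2 \<delta> by (auto simp: q_def field_simps)
  have expl: "exp (- (real m * l)) = q ^ m" for m
    using n1 \<delta> by (simp add: l_def q_def exp_minus exp_of_nat_mult power_divide field_simps)
  have n\<epsilon>: "real n * \<epsilon>\<^sup>2 = 256 * l"
    using n1 \<open>l \<ge> 0\<close> by (simp add: \<epsilon>_def power_mult_distrib flip: l_def)
  have \<epsilon>0: "\<epsilon> \<ge> 0" using \<open>l \<ge> 0\<close> by (simp add: \<epsilon>_def flip: l_def)
  \<comment> \<open>Accuracy has an exponent linear in \<open>\<epsilon>\<close>. Since
    \<open>l \<le> n\<close>, the square root in \<open>\<epsilon>\<close> dominates
    \<open>l / n\<close>.\<close>
  have "(l / real n)\<^sup>2 \<le> l / real n"
    using nl ln2 \<open>l \<ge> 0\<close> n1 unfolding power2_eq_square by (intro mult_left_le) (auto simp: field_simps)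
  then have "l / real n \<le> sqrt (l / real n)" by (rule real_le_rsqrt)
  then have "16 * l / real n \<le> \<epsilon>" by (simp add: \<epsilon>_def flip: l_def)
  then have "16 * l \<le> \<epsilon> * real n" using n1 by (simp add: field_simps)
  moreover have "\<epsilon> * real n \<le> \<epsilon> * (2 * real (n - 1))"
    using n2 \<epsilon>0 by (intro mult_left_mono) auto
  ultimately have "8 * l \<le> \<epsilon> * real (n - 1)" by simp
  then have "exp (- (\<epsilon> * real (n - 1))) \<le> q ^ 8"
    using expl[of 8] by (metis exp_le_cancel_iff neg_le_iff_le of_nat_numeral)
  then have "real (n + 1) * exp (- (\<epsilon> * real (n - 1))) \<le> (2 * real n) * q ^ 8"
    using n1 by (intro mult_mono) auto
  also have "\<dots> = \<delta> * (2 * q ^ 7)" by (simp add: q(3)[symmetric] eval_nat_numeral)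
  also have "\<dots> \<le> \<delta> * 1"
  proof (intro mult_left_mono)
    have "q ^ 7 \<le> (1 / 2) ^ 7" using q by (intro power_mono) auto
    then show "2 * q ^ 7 \<le> 1" by (simp add: eval_nat_numeral)
  qed (use \<delta> in auto)
  finally have acc: "real (n + 1) * exp (- (\<epsilon> * real (n - 1))) \<le> \<delta>" by simp
  show "accurate (threshold_class :: ('a \<Rightarrow> bool) set) n \<epsilon> \<delta> (decode \<circ> encode)"
    by (rule accurate_decode_encode[OF n1 \<epsilon>0 acc])
  have "(\<Sum>i\<le>2. (2 * n) ^ i) = 1 + 2 * n + 4 * n\<^sup>2"
    by (simp add: eval_nat_numeral algebra_simps)
  also have "\<dots> \<le> 6 * n\<^sup>2"
    using n2 mult_le_mono1[OF n2, of n] unfolding power2_eq_square by linarith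
  finally have "real (\<Sum>i\<le>2. (2 * n) ^ i) \<le> real (6 * n\<^sup>2)" by (rule of_nat_mono)
  moreover have "exp (- (real n * \<epsilon>\<^sup>2 / 8)) = q ^ 32"
    unfolding n\<epsilon> expl[of 32, symmetric] by simp
  ultimately have "4 * real (\<Sum>i\<le>2. (2 * n) ^ i) * exp (- (real n * \<epsilon>\<^sup>2 / 8)) \<le> 4 * real (6 * n\<^sup>2) * q ^ 32"
    using q by (simp only:) (intro mult_right_mono mult_left_mono; simp)
  \<comment> \<open>Two of the 32 factors \<open>q\<close> absorb \<open>n^2\<close> into
    \<open>\<delta>^2\<close>; the other 30 outweigh the constants because
    \<open>q \<le> 1 / 2\<close>.\<close>
  also have "\<dots> = (q * real n)\<^sup>2 * (24 * q ^ 30)"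
    by (simp add: power_mult_distrib flip: power_add)
  also have "\<dots> = \<delta>\<^sup>2 * (24 * q ^ 30)" unfolding q(3) ..
  also have "\<dots> \<le> \<delta>\<^sup>2 * (1 / 4)"
  proof (intro mult_left_mono)
    have "q ^ 30 \<le> (1 / 2) ^ 30" using q by (intro power_mono) auto
    then show "24 * q ^ 30 \<le> 1 / 4" by (simp add: eval_nat_numeral)
  qed simp
  finally have rob: "4 * real (\<Sum>i\<le>2. (2 * n) ^ i) * exp (- (real n * \<epsilon>\<^sup>2 / 8)) \<le> (\<delta> / 2)\<^sup>2"
    by (simp add: power_divide)
  show "robustly_generalizing n \<epsilon> \<delta>
      ((decode :: ('a \<times> bool) list \<Rightarrow> _) \<circ> encode)"
    using n\<epsilon> l by (intro robustly_generalizing_compression[OF encode_size n1 \<epsilon>0 _ \<delta>(1) rob]) simp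
qed

end
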